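(* Let $X$ be a real Hilbert space. Then $\big([\mathcal{P}(X)],\preceq\big)$ is a partially ordered set.
   Context: $X$ is a real Hilbert space with inner product $\langle\cdot,\cdot\rangle$ and induced norm $\|\cdot\|$. $\mathcal{F}(X)$ is the set of firmly nonexpansive mappings, i.e. $T\colon X\to X$ with $\|Tx-Ty\|^2\le\langle x-y,Tx-Ty\rangle$ for all $x,y\in X$. $\mathcal{P}(X)\subseteq\mathcal{F}(X)$ is the set of proximal mappings $P_f=(\operatorname{Id}+\partial f)^{-1}$, where $f$ ranges over $\Gamma_0(X)$, the convex, lower semicontinuous, proper functions $X\to\mathbb{R}\cup\{+\infty\}$, and $\partial f$ is the subdifferential. The resolvent order on $\mathcal{F}(X)$ is $T_1\preceq T_2 :\Leftrightarrow T_2-T_1\in\mathcal{F}(X)$. Define the equivalence relation $T_1\sim T_2:\Leftrightarrow T_2-T_1$ is a constant mapping on $\mathcal{F}(X)$; $[T]$ denotes the class of $T$, and $[\mathcal{P}(X)]=\{[P]: P\in\mathcal{P}(X)\}$ is the corresponding quotient set of $\mathcal{P}(X)$. On classes, $[T_1]\preceq[T_2]:\Leftrightarrow T_1\preceq T_2$. A partially ordered set is a set with a reflexive, antisymmetric, transitive relation. *)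

theory Defs
  imports "HOL-Analysis.Analysis"
begin

text \<open>
  A real Hilbert space is a type of class \<open>{real_inner, complete_space}\<close>; its dimension is arbitrary.
\<close>

definition firmly_nonexpansive_maps :: "('a::{real_inner,complete_space} \<Rightarrow> 'a) set" where
  "firmly_nonexpansive_maps =
     {T. \<forall>x y. (norm (T x - T y))\<^sup>2 \<le> inner (x - y) (T x - T y)}"

definition proper_fun :: "('a::{real_inner,complete_space} \<Rightarrow> ereal) \<Rightarrow> bool" where
  "proper_fun f \<longleftrightarrow> (\<forall>x. f x \<noteq> -\<infinity>) \<and> (\<exists>x. f x \<noteq> \<infinity>)"

text \<open>
  Only used for functions omitting \<open>-\<infinity>\<close>, so that no sum \<open>\<infinity> + (-\<infinity>)\<close> occurs.
\<close>

definition convex_fun :: "('a::{real_inner,complete_space} \<Rightarrow> ereal) \<Rightarrow> bool" where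
  "convex_fun f \<longleftrightarrow>
     (\<forall>x y t. 0 < t \<and> t < 1 \<longrightarrow>
        f ((1 - t) *\<^sub>R x + t *\<^sub>R y) \<le> ereal (1 - t) * f x + ereal t * f y)"

definition lsc_fun :: "('a::{real_inner,complete_space} \<Rightarrow> ereal) \<Rightarrow> bool" where
  "lsc_fun f \<longleftrightarrow> (\<forall>x. f x \<le> Liminf (at x) f)"

definition Gamma0 :: "('a::{real_inner,complete_space} \<Rightarrow> ereal) set" where
  "Gamma0 = {f. convex_fun f \<and> lsc_fun f \<and> proper_fun f}"

text \<open>
  For proper \<open>f\<close> this set is empty wherever \<open>f\<close> is \<open>\<infinity>\<close>, as is the usual convention.
\<close>

definition subdifferential :: "('a::{real_inner,complete_space} \<Rightarrow> ereal) \<Rightarrow> 'a \<Rightarrow> 'a set" where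
  "subdifferential f x = {u. \<forall>y. f x + ereal (inner (y - x) u) \<le> f y}"

definition setop_inverse :: "('a \<Rightarrow> 'b set) \<Rightarrow> 'b \<Rightarrow> 'a set" where
  "setop_inverse A y = {x. y \<in> A x}"

definition resolvent :: "('a::{real_inner,complete_space} \<Rightarrow> 'a set) \<Rightarrow> 'a \<Rightarrow> 'a set" where
  "resolvent A = setop_inverse (\<lambda>x. {x + u | u. u \<in> A x})"

text \<open>
  The resolvent of a subdifferential is a set-valued operator; \<open>T = (Id + \<partial>f)\<^sup>-\<^sup>1\<close> is read as an
  equality of set-valued operators, \<open>T\<close> being identified with \<open>\<lambda>x. {T x}\<close>.
\<close>

definition is_prox_of :: "('a::{real_inner,complete_space} \<Rightarrow> 'a) \<Rightarrow> ('a \<Rightarrow> ereal) \<Rightarrow> bool" where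
  "is_prox_of T f \<longleftrightarrow> (\<lambda>x. {T x}) = resolvent (subdifferential f)"

definition proximal_maps :: "('a::{real_inner,complete_space} \<Rightarrow> 'a) set" where
  "proximal_maps = {T. \<exists>f\<in>Gamma0. is_prox_of T f}"

definition resolvent_le ::
    "('a::{real_inner,complete_space} \<Rightarrow> 'a) \<Rightarrow> ('a \<Rightarrow> 'a) \<Rightarrow> bool"  (infix "\<preceq>\<^sub>r" 50) where
  "T1 \<preceq>\<^sub>r T2 \<longleftrightarrow> (\<lambda>x. T2 x - T1 x) \<in> firmly_nonexpansive_maps"

definition translation_equiv :: "('a::{real_inner,complete_space} \<Rightarrow> 'a) rel" where
  "translation_equiv =
     {(T1, T2). T1 \<in> firmly_nonexpansive_maps \<and> T2 \<in> firmly_nonexpansive_maps \<and>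
                (\<exists>c. \<forall>x. T2 x - T1 x = c)}"

abbreviation translation_class ::
    "('a::{real_inner,complete_space} \<Rightarrow> 'a) \<Rightarrow> ('a \<Rightarrow> 'a) set" where
  "translation_class T \<equiv> translation_equiv `` {T}"

definition prox_classes :: "('a::{real_inner,complete_space} \<Rightarrow> 'a) set set" where
  "prox_classes = proximal_maps // translation_equiv"

text \<open>
  The choice of representatives is immaterial, see \<open>class_le_iff\<close> below.
\<close>

definition class_le ::
    "('a::{real_inner,complete_space} \<Rightarrow> 'a) set \<Rightarrow> ('a \<Rightarrow> 'a) set \<Rightarrow> bool"  (infix "\<preceq>\<^sub>c" 50) where
  "C \<preceq>\<^sub>c D \<longleftrightarrow> (\<exists>T1\<in>C. \<exists>T2\<in>D. T1 \<preceq>\<^sub>r T2)"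

lemma equiv_translation_equiv:
  "equiv (firmly_nonexpansive_maps :: ('a::{real_inner,complete_space} \<Rightarrow> 'a) set) translation_equiv"
proof (rule equivI)
  show "translation_equiv \<subseteq> firmly_nonexpansive_maps \<times> firmly_nonexpansive_maps"
    by (auto simp: translation_equiv_def)
  show "refl_on firmly_nonexpansive_maps translation_equiv"
    by (auto simp: refl_on_def translation_equiv_def)
  show "sym (translation_equiv :: ('a \<Rightarrow> 'a) rel)"
  proof (rule symI)
    fix S T :: "'a \<Rightarrow> 'a"
    assume "(S, T) \<in> translation_equiv"
    then obtain c where c: "\<And>x. T x - S x = c"
      and F: "S \<in> firmly_nonexpansive_maps" "T \<in> firmly_nonexpansive_maps"
      by (auto simp: translation_equiv_def)
    have "S x - T x = - c" for x
      using c[of x] by (simp add: algebra_simps)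
    with F show "(T, S) \<in> translation_equiv"
      by (auto simp: translation_equiv_def)
  qed
  show "trans (translation_equiv :: ('a \<Rightarrow> 'a) rel)"
  proof (rule transI)
    fix S T U :: "'a \<Rightarrow> 'a"
    assume "(S, T) \<in> translation_equiv" "(T, U) \<in> translation_equiv"
    then obtain c d where c: "\<And>x. T x - S x = c" "\<And>x. U x - T x = d"
      and F: "S \<in> firmly_nonexpansive_maps" "U \<in> firmly_nonexpansive_maps"
      by (auto simp: translation_equiv_def)
    have "U x - S x = c + d" for x
      using c(1)[of x] c(2)[of x] by (metis add.commute diff_add_cancel add_diff_eq)
    with F show "(S, U) \<in> translation_equiv"
      by (auto simp: translation_equiv_def)
  qed
qed

lemma resolvent_le_translate:
  assumes "(S, S') \<in> translation_equiv" "(T, T') \<in> translation_equiv"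
  shows "S' \<preceq>\<^sub>r T' \<longleftrightarrow> S \<preceq>\<^sub>r T"
proof -
  obtain c d where c: "\<And>x. S' x - S x = c" and d: "\<And>x. T' x - T x = d"
    using assms by (auto simp: translation_equiv_def)
  have S': "S' x = S x + c" for x
    using c[of x] by (simp add: algebra_simps)
  have T': "T' x = T x + d" for x
    using d[of x] by (simp add: algebra_simps)
  have "(T' x - S' x) - (T' y - S' y) = (T x - S x) - (T y - S y)" for x y
    by (simp add: S' T' algebra_simps)
  then show ?thesis
    by (simp add: resolvent_le_def firmly_nonexpansive_maps_def)
qed

lemma class_le_iff:
  assumes "S \<in> firmly_nonexpansive_maps" "T \<in> firmly_nonexpansive_maps"
  shows "translation_class S \<preceq>\<^sub>c translation_class T \<longleftrightarrow> S \<preceq>\<^sub>r T"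
  using assms resolvent_le_translate equiv_class_self[OF equiv_translation_equiv]
  unfolding class_le_def by blast

lemma proximal_maps_subset:
  "(proximal_maps :: ('a::{real_inner,complete_space} \<Rightarrow> 'a) set) \<subseteq> firmly_nonexpansive_maps"
proof
  fix T :: "'a \<Rightarrow> 'a"
  assume "T \<in> proximal_maps"
  then obtain f where f: "f \<in> Gamma0" and T: "is_prox_of T f"
    by (auto simp: proximal_maps_def)
  from f have ninf: "f x \<noteq> -\<infinity>" for x
    by (simp add: Gamma0_def proper_fun_def)
  from f obtain z where z: "f z \<noteq> \<infinity>"
    by (auto simp: Gamma0_def proper_fun_def)
  have sub: "x - T x \<in> subdifferential f (T x)" for x
  proof -
    have "T x \<in> resolvent (subdifferential f) x"
      using T by (metis is_prox_of_def singletonI)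
    then obtain u where "x = T x + u" "u \<in> subdifferential f (T x)"
      by (auto simp: resolvent_def setop_inverse_def)
    moreover from this(1) have "u = x - T x"
      by (metis add_diff_cancel_left')
    ultimately show ?thesis
      by simp
  qed
  have ineq: "f (T x) + ereal (inner (y - T x) (x - T x)) \<le> f y" for x y
    using sub by (auto simp: subdifferential_def)
  have fin: "\<exists>r. f (T x) = ereal r" for x
    using ineq[of x z] z ninf[of "T x"] by (cases "f (T x)") auto
  have "(norm (T x - T y))\<^sup>2 \<le> inner (x - y) (T x - T y)" for x y
  proof -
    obtain r s where "f (T x) = ereal r" "f (T y) = ereal s"
      using fin by meson
    with ineq[of x "T y"] ineq[of y "T x"]
    have "inner (T y - T x) (x - T x) + inner (T x - T y) (y - T y) \<le> 0"
      by simp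
    then show ?thesis
      by (simp add: power2_norm_eq_inner inner_diff inner_commute algebra_simps)
  qed
  then show "T \<in> firmly_nonexpansive_maps"
    by (simp add: firmly_nonexpansive_maps_def)
qed

end

theory Submission
  imports Defs
begin

text \<open>
  Reflexivity and antisymmetry hold for all firmly nonexpansive maps; the content is transitivity.
  Let \<open>T1 \<preceq> T2 \<preceq> T3\<close> be proximal and \<open>H = T3 - T1\<close>.  A sum of two firmly nonexpansive maps such as
  \<open>H = (T3 - T2) + (T2 - T1)\<close> is monotone but in general not firmly nonexpansive.  Two further facts
  repair this.  First, \<open>H\<close> is bounded above: \<open>\<langle>Hx - Hy, x - y\<rangle> \<le> \<langle>T3 x - T3 y, x - y\<rangle> \<le> \<parallel>x - y\<parallel>\<^sup>2\<close>, because \<open>T1\<close>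
  is monotone and \<open>T3\<close> nonexpansive.  Secondly, \<open>H\<close> is a gradient: each proximal map \<open>P\<^sub>f\<close> is the
  gradient of the conjugate of \<open>f + \<parallel>\<cdot>\<parallel>\<^sup>2/2\<close> (\<open>proximal_map_has_potential\<close>), so \<open>H\<close> is the gradient of
  a difference of two such functions.  A gradient \<open>H\<close> for which both \<open>H\<close> and \<open>Id - H\<close> are monotone is
  firmly nonexpansive; this is the Baillon-Haddad theorem (\<open>gradient_firmly_nonexpansive\<close>), whose proof
  works because the potential lies between its tangent at any \<open>x\<close> and that tangent plus
  \<open>\<parallel>\<cdot> - x\<parallel>\<^sup>2/2\<close>.
\<close>

lemma monotone_gradient_above_tangent:
  fixes h :: "'a::real_inner \<Rightarrow> real"
  assumes grad: "\<And>x. (h has_derivative (\<lambda>v. inner v (H x))) (at x)"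
    and mono: "\<And>x y. 0 \<le> inner (x - y) (H x - H y)"
  shows "h x + inner (y - x) (H x) \<le> h y"
proof -
  define p where "p t = x + t *\<^sub>R (y - x)" for t
  have der: "((\<lambda>t. h (p t)) has_real_derivative inner (y - x) (H (p t))) (at t)" for t
  proof -
    have "(p has_derivative (\<lambda>s. s *\<^sub>R (y - x))) (at t)"
      unfolding p_def by (auto intro!: derivative_eq_intros)
    from has_derivative_compose[OF this grad]
    show ?thesis
      by (simp add: has_field_derivative_def mult.commute[of _ "inner _ _"])
  qed
  obtain s where s: "0 < s" "h (p 1) - h (p 0) = (1 - 0) * inner (y - x) (H (p s))"
    using MVT2[of 0 1 "\<lambda>t. h (p t)" "\<lambda>t. inner (y - x) (H (p t))"] der by auto
  have "0 \<le> s * inner (y - x) (H (p s) - H x)"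
    using mono[of "p s" x] by (simp add: p_def)
  with \<open>0 < s\<close> have "0 \<le> inner (y - x) (H (p s) - H x)"
    by (simp add: zero_le_mult_iff)
  with s(2) show ?thesis
    by (simp add: p_def inner_diff_right)
qed

text \<open>
  The Baillon-Haddad theorem, for potentials that are not assumed convex: convexity of \<open>h\<close> and of
  \<open>\<parallel>\<cdot>\<parallel>\<^sup>2/2 - h\<close> is encoded by monotonicity of their gradients.
\<close>

lemma gradient_firmly_nonexpansive:
  fixes h :: "'a::{real_inner,complete_space} \<Rightarrow> real"
  assumes grad: "\<And>x. (h has_derivative (\<lambda>v. inner v (H x))) (at x)"
    and mono: "\<And>x y. 0 \<le> inner (x - y) (H x - H y)"
    and upper: "\<And>x y. inner (x - y) (H x - H y) \<le> (norm (x - y))\<^sup>2"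
  shows "H \<in> firmly_nonexpansive_maps"
proof -
  have low: "h x + inner (y - x) (H x) \<le> h y" for x y
    using monotone_gradient_above_tangent[OF grad mono] .
  have up: "h y \<le> h x + inner (y - x) (H x) + inner (y - x) (y - x) / 2" for x y
  proof -
    have "((\<lambda>z. inner z z / 2 - h z) has_derivative (\<lambda>v. inner v (z - H z))) (at z)" for z
      by (auto intro!: derivative_eq_intros grad simp: inner_diff_right inner_commute)
    moreover have "0 \<le> inner (z - w) ((z - H z) - (w - H w))" for z w
    proof -
      have "(z - H z) - (w - H w) = (z - w) - (H z - H w)"
        by simp
      then show ?thesis
        using upper[of z w] by (simp only: inner_diff_right[of "z - w" "z - w"] power2_norm_eq_inner)
    qed
    ultimately have "inner x x / 2 - h x + inner (y - x) (x - H x) \<le> inner y y / 2 - h y"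
      by (rule monotone_gradient_above_tangent)
    then show ?thesis
      by (simp add: inner_diff_left inner_diff_right inner_commute field_simps)
  qed
  have half: "inner (H y - H x) (H y - H x) / 2 \<le> h y - h x - inner (y - x) (H x)" for x y
  proof -
    \<comment> \<open>The point minimising the quadratic upper bound at \<open>y\<close> minus the tangent at \<open>x\<close>.\<close>
    define z where "z = y - (H y - H x)"
    have "h x + inner (z - x) (H x) \<le> h y + inner (z - y) (H y) + inner (z - y) (z - y) / 2"
      using low[of x z] up[of z y] by linarith
    then show ?thesis
      by (simp add: z_def inner_diff_left inner_diff_right inner_add_left inner_add_right inner_commute field_simps)
  qed
  have "(norm (H x - H y))\<^sup>2 \<le> inner (x - y) (H x - H y)" for x y
    using half[of x y] half[of y x]
    by (simp add: power2_norm_eq_inner inner_diff_left inner_diff_right inner_commute field_simps)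
  then show ?thesis
    by (simp add: firmly_nonexpansive_maps_def)
qed

lemma firmly_nonexpansive_monotone:
  "T \<in> firmly_nonexpansive_maps \<Longrightarrow> 0 \<le> inner (x - y) (T x - T y)"
  unfolding firmly_nonexpansive_maps_def by (auto intro: order_trans[OF zero_le_power2])

lemma firmly_nonexpansive_nonexpansive:
  assumes "T \<in> firmly_nonexpansive_maps"
  shows "norm (T x - T y) \<le> norm (x - y)"
proof -
  have "(norm (T x - T y))\<^sup>2 \<le> norm (x - y) * norm (T x - T y)"
    using assms norm_cauchy_schwarz[of "x - y" "T x - T y"]
    unfolding firmly_nonexpansive_maps_def by (blast intro: order_trans)
  then show ?thesis
    by (cases "norm (T x - T y) = 0") (auto simp: power2_eq_square)
qed

lemma firmly_nonexpansive_upper: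
  assumes "T \<in> firmly_nonexpansive_maps"
  shows "inner (x - y) (T x - T y) \<le> (norm (x - y))\<^sup>2"
  using norm_cauchy_schwarz[of "x - y" "T x - T y"]
    mult_left_mono[OF firmly_nonexpansive_nonexpansive[OF assms, of x y] norm_ge_zero[of "x - y"]]
  by (simp add: power2_eq_square)

text \<open>
  A firmly nonexpansive selection of subgradients is a gradient, as the defect of the tangent at \<open>x\<close> is at
  most \<open>\<langle>T y - T x, y - x\<rangle> \<le> \<parallel>y - x\<parallel>\<^sup>2\<close>.
\<close>

lemma firmly_nonexpansive_subgradient_is_gradient:
  fixes g :: "'a::{real_inner,complete_space} \<Rightarrow> real"
  assumes sub: "\<And>x y. g x + inner (y - x) (T x) \<le> g y"
    and T: "T \<in> firmly_nonexpansive_maps"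
  shows "(g has_derivative (\<lambda>v. inner v (T x))) (at x)"
proof -
  have bound: "norm (g y - g x - inner (y - x) (T x)) / norm (y - x) \<le> norm (y - x)" for y
  proof -
    have "g y - g x - inner (y - x) (T x) \<le> inner (y - x) (T y - T x)"
      using sub[of y x] by (simp add: inner_diff_left inner_diff_right)
    also have "\<dots> \<le> (norm (y - x))\<^sup>2"
      by (rule firmly_nonexpansive_upper[OF T])
    finally have "norm (g y - g x - inner (y - x) (T x)) \<le> (norm (y - x))\<^sup>2"
      using sub[of x y] by simp
    then show ?thesis
      by (cases "y = x") (auto simp: divide_simps power2_eq_square)
  qed
  have "((\<lambda>y. norm (y - x)) \<longlongrightarrow> 0) (at x)"
    by (auto intro!: tendsto_eq_intros)
  then have "((\<lambda>y. norm (g y - g x - inner (y - x) (T x)) / norm (y - x)) \<longlongrightarrow> 0) (at x)"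
    by (rule Lim_null_comparison[rotated]) (use bound in simp)
  then show ?thesis
    by (simp add: has_derivative_iff_norm bounded_linear_inner_left)
qed

text \<open>
  The potential is \<open>(f + \<parallel>\<cdot>\<parallel>\<^sup>2/2)\<^sup>*\<close>, whose defining supremum of \<open>\<langle>x, z\<rangle> - f z - \<parallel>z\<parallel>\<^sup>2/2\<close> over \<open>z\<close> is
  attained at \<open>z = T x\<close>.
\<close>

lemma proximal_map_has_potential:
  fixes T :: "'a::{real_inner,complete_space} \<Rightarrow> 'a"
  assumes "T \<in> proximal_maps"
  obtains g :: "'a \<Rightarrow> real" where "\<And>x. (g has_derivative (\<lambda>v. inner v (T x))) (at x)"
proof -
  obtain f where f: "proper_fun f" and T: "(\<lambda>x. {T x}) = resolvent (subdifferential f)"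
    using assms by (auto simp: proximal_maps_def Gamma0_def is_prox_of_def)
  have ineq: "f (T x) + ereal (inner (y - T x) (x - T x)) \<le> f y" for x y
  proof -
    have "T x \<in> resolvent (subdifferential f) x"
      using fun_cong[OF T, of x] by blast
    then obtain u where "x = T x + u" "u \<in> subdifferential f (T x)"
      by (auto simp: resolvent_def setop_inverse_def)
    then show ?thesis
      unfolding subdifferential_def by (metis (mono_tags, lifting) add_diff_cancel_left' mem_Collect_eq)
  qed
  obtain z where "f z \<noteq> \<infinity>"
    using f by (auto simp: proper_fun_def)
  then have fin: "\<exists>r. f (T x) = ereal r" for x
    using ineq[of x z] f by (cases "f (T x)") (auto simp: proper_fun_def)
  define g where "g x = inner x (T x) - real_of_ereal (f (T x)) - inner (T x) (T x) / 2" for x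
  have "g x + inner (y - x) (T x) \<le> g y" for x y
  proof -
    obtain r s where rs: "f (T x) = ereal r" "f (T y) = ereal s"
      using fin by meson
    have "s + inner (T x - T y) (y - T y) \<le> r"
      using ineq[of y "T x"] by (simp add: rs)
    moreover have "0 \<le> inner (T x - T y) (T x - T y)"
      by simp
    ultimately show ?thesis
      by (simp add: g_def rs inner_diff_left inner_diff_right inner_commute field_simps)
  qed
  then show thesis
    using that firmly_nonexpansive_subgradient_is_gradient proximal_maps_subset assms by blast
qed

lemma resolvent_le_trans:
  assumes "T1 \<in> proximal_maps" "T3 \<in> proximal_maps"
    and "T1 \<preceq>\<^sub>r T2" "T2 \<preceq>\<^sub>r T3"
  shows "T1 \<preceq>\<^sub>r T3"
proof -
  obtain g1 g3 where g: "\<And>x. (g1 has_derivative (\<lambda>v. inner v (T1 x))) (at x)"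
      "\<And>x. (g3 has_derivative (\<lambda>v. inner v (T3 x))) (at x)"
    using assms(1,2) by (metis proximal_map_has_potential)
  have F: "T1 \<in> firmly_nonexpansive_maps" "T3 \<in> firmly_nonexpansive_maps"
    using assms(1,2) proximal_maps_subset by auto
  have "(\<lambda>x. T3 x - T1 x) \<in> firmly_nonexpansive_maps"
  proof (rule gradient_firmly_nonexpansive)
    fix x y
    show "((\<lambda>x. g3 x - g1 x) has_derivative (\<lambda>v. inner v (T3 x - T1 x))) (at x)"
      unfolding inner_diff_right by (intro has_derivative_diff g)
    show "0 \<le> inner (x - y) ((T3 x - T1 x) - (T3 y - T1 y))"
      using assms(3,4)[unfolded resolvent_le_def, THEN firmly_nonexpansive_monotone, of x y]
      by (simp add: inner_diff_right)
    show "inner (x - y) ((T3 x - T1 x) - (T3 y - T1 y)) \<le> (norm (x - y))\<^sup>2"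
      using firmly_nonexpansive_upper[OF F(2), of x y] firmly_nonexpansive_monotone[OF F(1), of x y]
      by (simp add: inner_diff_right)
  qed
  then show ?thesis
    by (simp add: resolvent_le_def)
qed

lemma resolvent_le_antisym:
  assumes "S \<in> firmly_nonexpansive_maps" "T \<in> firmly_nonexpansive_maps"
    and "S \<preceq>\<^sub>r T" "T \<preceq>\<^sub>r S"
  shows "(S, T) \<in> translation_equiv"
proof -
  have "T x - S x = T 0 - S 0" for x
  proof -
    have "(norm ((T x - S x) - (T 0 - S 0)))\<^sup>2 \<le> inner (x - 0) ((T x - S x) - (T 0 - S 0))"
      using assms(3) unfolding resolvent_le_def firmly_nonexpansive_maps_def by blast
    also have "\<dots> \<le> 0"
      using firmly_nonexpansive_monotone[OF assms(4)[unfolded resolvent_le_def], of x 0]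
      by (simp add: inner_diff_right)
    finally show ?thesis
      by simp
  qed
  with assms(1,2) show ?thesis
    unfolding translation_equiv_def by blast
qed

theorem mainTheorem6:
  shows "partial_order_on
           (prox_classes :: ('a::{real_inner,complete_space} \<Rightarrow> 'a) set set)
           {(C, D). C \<in> prox_classes \<and> D \<in> prox_classes \<and> C \<preceq>\<^sub>c D}"
proof -
  have rep: "\<exists>T\<in>proximal_maps. T \<in> firmly_nonexpansive_maps \<and> C = translation_class T"
    if "C \<in> prox_classes" for C :: "('a \<Rightarrow> 'a) set"
    using that proximal_maps_subset unfolding prox_classes_def by (blast elim!: quotientE)
  have refl: "C \<preceq>\<^sub>c C" if "C \<in> prox_classes" for C :: "('a \<Rightarrow> 'a) set"
    using rep[OF that] by (auto simp: class_le_iff resolvent_le_def firmly_nonexpansive_maps_def)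
  have antisym: "C = D" if "C \<in> prox_classes" "D \<in> prox_classes" "C \<preceq>\<^sub>c D" "D \<preceq>\<^sub>c C"
    for C D :: "('a \<Rightarrow> 'a) set"
    using rep[OF that(1)] rep[OF that(2)] that(3,4)
    by (metis class_le_iff resolvent_le_antisym equiv_class_eq[OF equiv_translation_equiv])
  have trans: "C \<preceq>\<^sub>c E"
    if "C \<in> prox_classes" "D \<in> prox_classes" "E \<in> prox_classes" "C \<preceq>\<^sub>c D" "D \<preceq>\<^sub>c E"
    for C D E :: "('a \<Rightarrow> 'a) set"
    using rep[OF that(1)] rep[OF that(2)] rep[OF that(3)] that(4,5)
    by (metis class_le_iff resolvent_le_trans)
  show ?thesis
    unfolding partial_order_on_def preorder_on_def refl_on_def
    by (auto intro!: transI antisymI refl dest: antisym elim: trans)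
qed

end
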